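(* Let $(X, \rho)$ be a compact geodesic space, let $\{(G_n, \rho_n)\}_{n \in \mathbb{N}}$ be a sequence of finite metric graphs, and let $T>0$ and $\alpha>0$. If $d_{\mathrm{GH}}(X, G_n)\rightarrow 0$ as $n\rightarrow \infty$, then the following statements are equivalent: (1) for all $\tilde{\alpha}>\alpha$ there are $(X, \rho, \tilde{\alpha}, T)$-winning strategies; (2) there is a sequence of positive numbers $(\alpha_n)_{n\in\mathbb{N}}$ with $\alpha_n \rightarrow \alpha$ as $n\rightarrow\infty$ such that for each $n\in \mathbb{N}$ there are $(G_n, \rho_n, \alpha_n, T)$-winning strategies.
   Context: A metric space $(X,\rho)$ is a geodesic space if every two points $x,y\in X$ are joined by a geodesic path, i.e. a map $g\colon[0,l]\to X$ with $g(0)=x$, $g(l)=y$ and $\rho(g(t),g(t'))=|t-t'|$ for all $t,t'\in[0,l]$. A finite metric graph is a metric space obtained from a finite connected graph (finitely many vertices and finitely many edges) by identifying each edge with a segment of positive finite length, gluing the segments at the vertices, and equipping the result with the induced length (shortest path) metric; it is a compact geodesic space. $d_{\mathrm{GH}}$ denotes the Gromov--Hausdorff distance: $d_{\mathrm{GH}}(X,Y)$ is the infimum of $r>0$ for which there exist a metric space $Z$ and subspaces $X',Y'\subset Z$ isometric to $X$ and $Y$ respectively with $d_{\mathrm{H}}(X',Y')<r$, where $d_{\mathrm{H}}$ is the Hausdorff distance between subsets of $Z$. For a metric space $(X,\rho)$, let $\mathrm{Lip}_1(X)$ be the set of all 1-Lipschitz curves from $\mathbb{R}_+=[0,+\infty)$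 to $X$ (the admissible trajectories of each player, Lion and Man). For $L_0\in X$, a map $\mathfrak{s}_{L_0}\colon \mathrm{Lip}_1(X)\to \mathrm{Lip}_1(X)$ is called a (Lion's) non-anticipative strategy with initial position $L_0$ if $\mathfrak{s}_{L_0}(M)(0)=L_0$ for all $M\in \mathrm{Lip}_1(X)$, and for all $M_1,M_2\in \mathrm{Lip}_1(X)$ and $\tau\ge 0$: if $M_1(t)=M_2(t)$ for all $t\in[0,\tau]$, then $\mathfrak{s}_{L_0}(M_1)(t)=\mathfrak{s}_{L_0}(M_2)(t)$ for all $t\in[0,\tau]$. For a compact metric space $(X,\rho)$ and a number $\alpha>0$, "there are $(X,\rho,\alpha,T)$-winning strategies" means: for every $L_0\in X$ there is a non-anticipative strategy $\mathfrak{s}_{L_0}\colon \mathrm{Lip}_1(X)\to \mathrm{Lip}_1(X)$ with initial position $L_0$ such that $\inf_{t\in[0,T]}\rho\bigl(M(t),\mathfrak{s}_{L_0}(M)(t)\bigr)\le\alpha$ for all $M\in \mathrm{Lip}_1(X)$. *)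

theory Defs
  imports "HOL-Analysis.Analysis" "Graph_Theory.Digraph_Component"
begin

section \<open>Geodesic spaces and isometries\<close>

definition geodesic_space :: "'a metric \<Rightarrow> bool" where
  "geodesic_space X \<longleftrightarrow>
     (\<forall>x\<in>mspace X. \<forall>y\<in>mspace X. \<exists>l\<ge>0. \<exists>g\<in>{0..l} \<rightarrow> mspace X.
        g 0 = x \<and> g l = y \<and>
        (\<forall>t\<in>{0..l}. \<forall>t'\<in>{0..l}. mdist X (g t) (g t') = \<bar>t - t'\<bar>))"

definition isometric :: "'a metric \<Rightarrow> 'b metric \<Rightarrow> bool" where
  "isometric X Y \<longleftrightarrow>
     (\<exists>f. bij_betw f (mspace X) (mspace Y) \<and>
          (\<forall>x\<in>mspace X. \<forall>x'\<in>mspace X. mdist Y (f x) (f x') = mdist X x x'))"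


section \<open>Finite metric graphs\<close>

text \<open>
  The underlying graph is a multigraph (loops and parallel edges are allowed), given as a digraph:
  the direction of an arc only fixes which end of the segment \<open>[0, len e]\<close> is glued to which
  vertex, and connectedness is that of the underlying undirected graph. The glued space is
  represented by its vertices and the interior points of its edges.
\<close>

datatype ('v, 'e) graph_point = Vertex 'v | Interior 'e real

definition graph_points ::
    "('v, 'e) pre_digraph \<Rightarrow> ('e \<Rightarrow> real) \<Rightarrow> ('v, 'e) graph_point set" where
  "graph_points \<Gamma> len =
     Vertex ` verts \<Gamma> \<union> {Interior e t | e t. e \<in> arcs \<Gamma> \<and> 0 < t \<and> t < len e}"

text \<open>The image in the glued space of the parameter \<open>t\<close> of the segment \<open>[0, len e]\<close>.\<close>

definition edge_point ::
    "('v, 'e) pre_digraph \<Rightarrow> ('e \<Rightarrow> real) \<Rightarrow> 'e \<Rightarrow> real \<Rightarrow> ('v, 'e) graph_point" where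
  "edge_point \<Gamma> len e t =
     (if t = 0 then Vertex (tail \<Gamma> e)
      else if t = len e then Vertex (head \<Gamma> e)
      else Interior e t)"

text \<open>
  \<open>graph_path \<Gamma> len p q L\<close>: there is a path of length \<open>L\<close> from \<open>p\<close> to \<open>q\<close>, formed by
  concatenating finitely many straight pieces, each contained in a single closed edge.
\<close>

inductive graph_path ::
    "('v, 'e) pre_digraph \<Rightarrow> ('e \<Rightarrow> real) \<Rightarrow>
     ('v, 'e) graph_point \<Rightarrow> ('v, 'e) graph_point \<Rightarrow> real \<Rightarrow> bool"
  for \<Gamma> :: "('v, 'e) pre_digraph" and len :: "'e \<Rightarrow> real" where
  trivial: "p \<in> graph_points \<Gamma> len \<Longrightarrow> graph_path \<Gamma> len p p 0"
| piece: "\<lbrakk>e \<in> arcs \<Gamma>; s \<in> {0..len e}; t \<in> {0..len e}; graph_path \<Gamma> len (edge_point \<Gamma> len e t) q L\<rbrakk>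
     \<Longrightarrow> graph_path \<Gamma> len (edge_point \<Gamma> len e s) q (\<bar>s - t\<bar> + L)"

definition graph_dist ::
    "('v, 'e) pre_digraph \<Rightarrow> ('e \<Rightarrow> real) \<Rightarrow>
     ('v, 'e) graph_point \<Rightarrow> ('v, 'e) graph_point \<Rightarrow> real" where
  "graph_dist \<Gamma> len p q = Inf {L. graph_path \<Gamma> len p q L}"

text \<open>
  Vertices and edges are named by natural numbers, which is no restriction for finite graphs.
  \<open>Digraph_Component.connected\<close> includes that there is at least one vertex.
\<close>

definition finite_metric_graph :: "'a metric \<Rightarrow> bool" where
  "finite_metric_graph G \<longleftrightarrow>
     (\<exists>(\<Gamma> :: (nat, nat) pre_digraph) len f.
        fin_digraph \<Gamma> \<and> Digraph_Component.connected \<Gamma> \<and> (\<forall>e\<in>arcs \<Gamma>. len e > 0) \<and>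
        bij_betw f (graph_points \<Gamma> len) (mspace G) \<and>
        (\<forall>p\<in>graph_points \<Gamma> len. \<forall>q\<in>graph_points \<Gamma> len.
           mdist G (f p) (f q) = graph_dist \<Gamma> len p q))"


section \<open>Gromov--Hausdorff distance\<close>

definition hausdorff_dist :: "'a metric \<Rightarrow> 'a set \<Rightarrow> 'a set \<Rightarrow> ennreal" where
  "hausdorff_dist Z A B =
     max (SUP a\<in>A. INF b\<in>B. ennreal (mdist Z a b)) (SUP b\<in>B. INF a\<in>A. ennreal (mdist Z a b))"

text \<open>
  A definition cannot quantify over all types, so \<open>Z\<close> ranges over the metric spaces whose points
  are taken from \<^typ>\<open>'a + 'b\<close>. As \<open>Z\<close> may be cut down to the union of \<open>X'\<close> and \<open>Y'\<close>, this
  yields the same infimum; see \<open>gh_dist_le\<close> below.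
\<close>

definition gh_dist :: "'a metric \<Rightarrow> 'b metric \<Rightarrow> ennreal" where
  "gh_dist X Y =
     Inf {ennreal r | r. r > 0 \<and>
       (\<exists>(Z :: ('a + 'b) metric) X' Y'. X' \<subseteq> mspace Z \<and> Y' \<subseteq> mspace Z \<and>
          isometric X (submetric Z X') \<and> isometric Y (submetric Z Y') \<and>
          hausdorff_dist Z X' Y' < ennreal r)}"

lemma gh_dist_le:
  fixes X :: "'a metric" and Y :: "'b metric" and Z :: "'c metric"
  assumes "X' \<subseteq> mspace Z" "Y' \<subseteq> mspace Z"
    and "isometric X (submetric Z X')" "isometric Y (submetric Z Y')"
    and "r > 0" "hausdorff_dist Z X' Y' < ennreal r"
  shows "gh_dist X Y \<le> ennreal r"
proof -
  obtain f where f: "bij_betw f (mspace X) X'"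
      "\<And>x x'. x \<in> mspace X \<Longrightarrow> x' \<in> mspace X \<Longrightarrow> mdist Z (f x) (f x') = mdist X x x'"
    using assms(1,3) by (auto simp: isometric_def Int_absorb2)
  obtain g where g: "bij_betw g (mspace Y) Y'"
      "\<And>y y'. y \<in> mspace Y \<Longrightarrow> y' \<in> mspace Y \<Longrightarrow> mdist Z (g y) (g y') = mdist Y y y'"
    using assms(2,4) by (auto simp: isometric_def Int_absorb2)
  define h :: "'c \<Rightarrow> 'a + 'b" where
    "h z = (if z \<in> X' then Inl (inv_into (mspace X) f z) else Inr (inv_into (mspace Y) g z))" for z
  define U where "U = X' \<union> Y'"
  have "inj_on (inv_into (mspace X) f) X'" "inj_on (inv_into (mspace Y) g) Y'"
    using bij_betw_inv_into[OF f(1)] bij_betw_inv_into[OF g(1)] by (auto simp: bij_betw_def)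
  then have inj: "inj_on h U"
    unfolding inj_on_def U_def h_def by auto
  define k where "k = inv_into U h"
  have kh [simp]: "k (h z) = z" if "z \<in> U" for z
    using inj that by (simp add: k_def)
  have U: "U \<subseteq> mspace Z" using assms(1,2) by (auto simp: U_def)
  define D where "D p q = mdist Z (k p) (k q)" for p q
  have D: "D (h z) (h z') = mdist Z z z'" if "z \<in> U" "z' \<in> U" for z z'
    using that by (simp add: D_def)
  have MD: "Metric_space (h ` U) D"
  proof
    fix p q show "0 \<le> D p q" by (simp add: D_def)
    show "D p q = D q p" by (simp add: D_def mdist_commute)
  next
    fix p q assume "p \<in> h ` U" "q \<in> h ` U"
    then show "D p q = 0 \<longleftrightarrow> p = q" using U by (auto simp: D subset_iff)
  next
    fix p q s assume "p \<in> h ` U" "q \<in> h ` U" "s \<in> h ` U"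
    then show "D p s \<le> D p q + D q s"
      using U by (auto simp: D subset_iff intro!: mdist_triangle)
  qed
  define W where "W = metric (h ` U, D)"
  have W [simp]: "mspace W = h ` U" "mdist W = D"
    using MD by (simp_all add: W_def Metric_space.mspace_metric Metric_space.mdist_metric)
  have sub: "h ` X' \<subseteq> h ` U" "h ` Y' \<subseteq> h ` U" by (auto simp: U_def)
  have bX: "bij_betw h X' (h ` X')" and bY: "bij_betw h Y' (h ` Y')"
    using inj by (auto simp: bij_betw_def U_def inj_on_Un)
  have "isometric X (submetric W (h ` X'))"
    unfolding isometric_def
  proof (intro exI conjI ballI)
    show "bij_betw (h \<circ> f) (mspace X) (mspace (submetric W (h ` X')))"
      using bij_betw_trans[OF f(1) bX] sub by (simp add: Int_absorb2)
    fix x x' assume "x \<in> mspace X" "x' \<in> mspace X"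
    moreover from this have "f x \<in> U" "f x' \<in> U"
      using bij_betwE[OF f(1)] by (auto simp: U_def)
    ultimately show "mdist (submetric W (h ` X')) ((h \<circ> f) x) ((h \<circ> f) x') = mdist X x x'"
      by (simp add: D f(2))
  qed
  moreover have "isometric Y (submetric W (h ` Y'))"
    unfolding isometric_def
  proof (intro exI conjI ballI)
    show "bij_betw (h \<circ> g) (mspace Y) (mspace (submetric W (h ` Y')))"
      using bij_betw_trans[OF g(1) bY] sub by (simp add: Int_absorb2)
    fix y y' assume "y \<in> mspace Y" "y' \<in> mspace Y"
    moreover from this have "g y \<in> U" "g y' \<in> U"
      using bij_betwE[OF g(1)] by (auto simp: U_def)
    ultimately show "mdist (submetric W (h ` Y')) ((h \<circ> g) y) ((h \<circ> g) y') = mdist Y y y'"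
      by (simp add: D g(2))
  qed
  moreover have "hausdorff_dist W (h ` X') (h ` Y') = hausdorff_dist Z X' Y'"
    unfolding hausdorff_dist_def W image_image
    by (intro arg_cong2[where f = max] SUP_cong INF_cong refl) (simp_all add: D U_def)
  ultimately have "\<exists>(Z :: ('a + 'b) metric) X' Y'. X' \<subseteq> mspace Z \<and> Y' \<subseteq> mspace Z \<and>
      isometric X (submetric Z X') \<and> isometric Y (submetric Z Y') \<and>
      hausdorff_dist Z X' Y' < ennreal r"
    using assms(6) sub by (intro exI[of _ W] exI[of _ "h ` X'"] exI[of _ "h ` Y'"]) simp
  then show ?thesis
    unfolding gh_dist_def using assms(5) by (intro Inf_lower) blast
qed


section \<open>The Lion and Man game\<close>

text \<open>Curves have domain \<open>{0..}\<close>, hence are extensional functions.\<close>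

definition Lip1 :: "'a metric \<Rightarrow> (real \<Rightarrow> 'a) set" where
  "Lip1 X = {c \<in> {0..} \<rightarrow>\<^sub>E mspace X. \<forall>s\<ge>0. \<forall>t\<ge>0. mdist X (c s) (c t) \<le> \<bar>s - t\<bar>}"

definition nonanticipative_strategy ::
    "'a metric \<Rightarrow> 'a \<Rightarrow> ((real \<Rightarrow> 'a) \<Rightarrow> (real \<Rightarrow> 'a)) \<Rightarrow> bool" where
  "nonanticipative_strategy X L\<^sub>0 \<sigma> \<longleftrightarrow>
     \<sigma> \<in> Lip1 X \<rightarrow> Lip1 X \<and>
     (\<forall>M\<in>Lip1 X. \<sigma> M 0 = L\<^sub>0) \<and>
     (\<forall>M\<^sub>1\<in>Lip1 X. \<forall>M\<^sub>2\<in>Lip1 X. \<forall>\<tau>\<ge>0.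
        (\<forall>t\<in>{0..\<tau>}. M\<^sub>1 t = M\<^sub>2 t) \<longrightarrow> (\<forall>t\<in>{0..\<tau>}. \<sigma> M\<^sub>1 t = \<sigma> M\<^sub>2 t))"

definition winning_strategies :: "'a metric \<Rightarrow> real \<Rightarrow> real \<Rightarrow> bool" where
  "winning_strategies X \<alpha> T \<longleftrightarrow>
     (\<forall>L\<^sub>0\<in>mspace X. \<exists>\<sigma>. nonanticipative_strategy X L\<^sub>0 \<sigma> \<and>
        (\<forall>M\<in>Lip1 X. (INF t\<in>{0..T}. mdist X (M t) (\<sigma> M t)) \<le> \<alpha>))"

end

theory Submission
  imports Defs
begin

text \<open>
  Two spaces at small Gromov--Hausdorff distance are related by a correspondence \<open>R\<close> that distorts
  distances by at most a small \<open>\<delta>\<close>, and a strategy on one of them can be simulated on the other.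
  Lion, playing on \<open>Y\<close>, translates Man's curve on \<open>Y\<close> into a curve on \<open>X\<close>, lets the given strategy
  answer there, and translates the answer back to \<open>Y\<close>. If capture up to \<open>\<alpha>\<close> takes place on \<open>X\<close>
  at some time in \<open>[0, T]\<close>, capture up to \<open>\<alpha>\<close> plus a small error takes place on \<open>Y\<close> at the same time.

  A curve cannot be translated pointwise: a choice function of \<open>R\<close> is in general discontinuous.
  Instead the curve is sampled at the times \<open>0, h, 2h, \<dots>\<close>, the samples are mapped by the choice
  function, and consecutive images are joined by curves. The images of consecutive samples are at
  most \<open>h + \<delta>\<close> apart, so unit speed suffices if each joining curve is given the time
  \<open>l = h + 2\<delta>\<close>. The resulting \<open>shadow\<close> runs behind the original in two ways: it uses a sample
  only once the sample is known, which makes the translation non-anticipative, and its clock is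
  slower by the factor \<open>h / l\<close>. Up to time \<open>T\<close> both effects together amount to at most
  \<open>\<eta> = h + 2\<delta> + 2\<delta>T/h\<close> (lemma \<open>shadow_close\<close>). This is small if \<open>h\<close> is small and \<open>\<delta>\<close> is
  small compared with \<open>h\<close>, and the capture radius grows by no more than \<open>4\<eta> + \<delta>\<close>
  (lemma \<open>winning_strategies_transfer\<close>).

  The joining curves may be slightly longer than the distance of their ends, which is exactly what a
  length space provides. In a metric graph such curves come from the infimum that defines the graph
  distance.

  For the equivalence, let \<open>a\<^sub>n\<close> be slightly larger than the infimum of the radii \<open>\<ge> \<alpha>\<close> with which
  Lion wins on \<open>G\<^sub>n\<close>; some such radius exists because \<open>G\<^sub>n\<close> is bounded, and by the transfer the
  infima tend to \<open>\<alpha>\<close>. The converse is the transfer from \<open>G\<^sub>n\<close> to \<open>X\<close> for one large \<open>n\<close>.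
\<close>


section \<open>Lipschitz curves and length spaces\<close>

lemma mdist_self [simp]: "x \<in> mspace X \<Longrightarrow> mdist X x x = 0"
  by simp

lemma Lip1_mspace: "c \<in> Lip1 X \<Longrightarrow> t \<ge> 0 \<Longrightarrow> c t \<in> mspace X"
  by (auto simp: Lip1_def)

lemma Lip1_mdist: "c \<in> Lip1 X \<Longrightarrow> s \<ge> 0 \<Longrightarrow> t \<ge> 0 \<Longrightarrow> mdist X (c s) (c t) \<le> \<bar>s - t\<bar>"
  by (auto simp: Lip1_def)

lemma restrict_in_Lip1:
  assumes "\<And>t. t \<ge> 0 \<Longrightarrow> c t \<in> mspace X"
    and "\<And>s t. 0 \<le> s \<Longrightarrow> s \<le> t \<Longrightarrow> mdist X (c s) (c t) \<le> t - s"
  shows "restrict c {0..} \<in> Lip1 X"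
proof -
  have "mdist X (c s) (c t) \<le> \<bar>s - t\<bar>" if "s \<ge> 0" "t \<ge> 0" for s t
    using assms(2)[of s t] assms(2)[of t s] that by (cases "s \<le> t") (auto simp: mdist_commute)
  then show ?thesis using assms(1) by (auto simp: Lip1_def)
qed

lemma const_in_Lip1:
  assumes "x \<in> mspace X"
  shows "(\<lambda>t\<in>{0..}. x) \<in> Lip1 X"
  using assms by (intro restrict_in_Lip1) auto

lemma Lipschitz_glue:
  fixes c :: "real \<Rightarrow> 'a"
  assumes "\<And>t. 0 \<le> t \<Longrightarrow> c t \<in> mspace X" and "0 \<le> b"
    and "\<And>s t. 0 \<le> s \<Longrightarrow> s \<le> t \<Longrightarrow> t \<le> b \<Longrightarrow> mdist X (c s) (c t) \<le> t - s"
    and "\<And>s t. b \<le> s \<Longrightarrow> s \<le> t \<Longrightarrow> t \<le> e \<Longrightarrow> mdist X (c s) (c t) \<le> t - s"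
    and "0 \<le> s" "s \<le> t" "t \<le> e"
  shows "mdist X (c s) (c t) \<le> t - s"
proof -
  consider "t \<le> b" | "b \<le> s" | "s \<le> b" "b \<le> t" by linarith
  then show ?thesis
  proof cases
    case 3
    have "mdist X (c s) (c t) \<le> mdist X (c s) (c b) + mdist X (c b) (c t)"
      using assms 3 by (intro mdist_triangle) auto
    also have "\<dots> \<le> (b - s) + (t - b)"
      using assms(3)[of s b] assms(4)[of b t] assms(5-7) 3 by auto
    finally show ?thesis by simp
  qed (use assms in auto)
qed

lemma Lip1_concat:
  assumes c: "c\<^sub>1 \<in> Lip1 X" "c\<^sub>2 \<in> Lip1 X" and a: "0 \<le> a" and eq: "c\<^sub>1 a = c\<^sub>2 0"
  obtains c where "c \<in> Lip1 X" "c 0 = c\<^sub>1 0" "\<And>b. 0 \<le> b \<Longrightarrow> c (a + b) = c\<^sub>2 b"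
proof -
  define d where "d t = (if t \<le> a then c\<^sub>1 t else c\<^sub>2 (t - a))" for t
  have d2: "d t = c\<^sub>2 (t - a)" if "a \<le> t" for t
    using that eq by (auto simp: d_def)
  have in_space: "d t \<in> mspace X" if "0 \<le> t" for t
    using that c by (auto simp: d_def intro: Lip1_mspace)
  have "restrict d {0..} \<in> Lip1 X"
  proof (rule restrict_in_Lip1[OF in_space])
    fix s t :: real assume st: "0 \<le> s" "s \<le> t"
    show "mdist X (d s) (d t) \<le> t - s"
    proof (rule Lipschitz_glue[where c = d and b = a and e = t])
      show "mdist X (d s) (d t) \<le> t - s" if "0 \<le> s" "s \<le> t" "t \<le> a" for s t
        using Lip1_mdist[OF c(1), of s t] that by (simp add: d_def)
      show "mdist X (d s) (d t) \<le> t - s" if "a \<le> s" "s \<le> t" for s t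
        using Lip1_mdist[OF c(2), of "s - a" "t - a"] that by (simp add: d2)
    qed (use st a in_space in auto)
  qed
  then show ?thesis
    using a d2 eq by (intro that[of "restrict d {0..}"]) (auto simp: d_def)
qed

lemma Lip1_stop:
  assumes "c \<in> Lip1 X" "0 \<le> a"
  obtains c' where "c' \<in> Lip1 X" "c' 0 = c 0" "\<And>t. a \<le> t \<Longrightarrow> c' t = c a"
proof
  have "mdist X (c (min s a)) (c (min t a)) \<le> t - s" if "0 \<le> s" "s \<le> t" for s t
    using Lip1_mdist[OF assms(1), of "min s a" "min t a"] assms(2) that by (auto simp: min_def split: if_splits)
  then show "(\<lambda>t\<in>{0..}. c (min t a)) \<in> Lip1 X"
    using assms by (intro restrict_in_Lip1) (auto intro!: Lip1_mspace)
qed (use assms(2) in \<open>auto simp: min_def\<close>)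

text \<open>
  Putting \<open>l\<close> strictly above the distance asks only for almost shortest curves. A curve that arrives
  early can wait at its end, hence arrival at exactly the time \<open>l\<close> is no restriction.
\<close>

definition length_space :: "'a metric \<Rightarrow> bool" where
  "length_space X \<longleftrightarrow>
     (\<forall>x\<in>mspace X. \<forall>y\<in>mspace X. \<forall>l>mdist X x y. \<exists>c\<in>Lip1 X. c 0 = x \<and> c l = y)"

lemma geodesic_imp_length_space:
  assumes "geodesic_space X"
  shows "length_space X"
  unfolding length_space_def
proof (intro ballI allI impI)
  fix x y l assume xy: "x \<in> mspace X" "y \<in> mspace X" and l: "mdist X x y < l"
  then obtain k g where k: "k \<ge> 0" and g: "g \<in> {0..k} \<rightarrow> mspace X" "g 0 = x" "g k = y"
    and iso: "\<And>t t'. t \<in> {0..k} \<Longrightarrow> t' \<in> {0..k} \<Longrightarrow> mdist X (g t) (g t') = \<bar>t - t'\<bar>"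
    using assms unfolding geodesic_space_def by metis
  have "k < l"
    using iso[of 0 k] k g l by simp
  define c where "c = (\<lambda>t\<in>{0..}. g (min t k))"
  have "c \<in> Lip1 X"
    unfolding c_def
  proof (rule restrict_in_Lip1)
    show "g (min t k) \<in> mspace X" if "t \<ge> 0" for t
      using that k by (intro funcset_mem[OF g(1)]) auto
    show "mdist X (g (min s k)) (g (min t k)) \<le> t - s" if "0 \<le> s" "s \<le> t" for s t
      using that k iso[of "min s k" "min t k"] by auto
  qed
  then show "\<exists>c\<in>Lip1 X. c 0 = x \<and> c l = y"
    using k g \<open>k < l\<close> by (intro bexI[of _ c]) (auto simp: c_def min_def)
qed

definition connect :: "'a metric \<Rightarrow> 'a \<Rightarrow> 'a \<Rightarrow> real \<Rightarrow> real \<Rightarrow> 'a" where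
  "connect X x y l = (SOME c. c \<in> Lip1 X \<and> c 0 = x \<and> c l = y)"

lemma connect:
  assumes "length_space X" "x \<in> mspace X" "y \<in> mspace X" "mdist X x y < l"
  shows "connect X x y l \<in> Lip1 X" "connect X x y l 0 = x" "connect X x y l l = y"
proof -
  have "\<exists>c. c \<in> Lip1 X \<and> c 0 = x \<and> c l = y"
    using assms unfolding length_space_def by blast
  from someI_ex[OF this]
  show "connect X x y l \<in> Lip1 X" "connect X x y l 0 = x" "connect X x y l l = y"
    unfolding connect_def by auto
qed


section \<open>Shadowing a curve in a nearby space\<close>

text \<open>
  During the \<open>k\<close>-th time segment \<open>[k l, (k + 1) l]\<close> the shadow travels from the image of sample
  \<open>k - 1\<close> to the image of sample \<open>k\<close>, the latter being known since its time \<open>k h\<close> is at most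
  \<open>k l\<close>. Because of truncated subtraction the segment \<open>k = 0\<close> begins and ends at the
  image of sample \<open>0\<close>, since no earlier sample exists.
\<close>

definition shadow ::
    "'b metric \<Rightarrow> ('a \<Rightarrow> 'b) \<Rightarrow> real \<Rightarrow> real \<Rightarrow> (real \<Rightarrow> 'a) \<Rightarrow> real \<Rightarrow> 'b" where
  "shadow Y f h l c = (\<lambda>t\<in>{0..}. let k = nat \<lfloor>t / l\<rfloor> in
     connect Y (f (c (real (k - 1) * h))) (f (c (real k * h))) l (t - real k * l))"

text \<open>
  This is the non-anticipativity of the translation: all samples that influence the shadow up to
  time \<open>t\<close> are taken no later than \<open>t\<close>, because \<open>h \<le> l\<close>.
\<close>

lemma shadow_cong:
  assumes "0 < h" "h \<le> l" "\<And>t. t \<in> {0..\<tau>} \<Longrightarrow> c\<^sub>1 t = c\<^sub>2 t" and "t \<in> {0..\<tau>}"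
  shows "shadow Y f h l c\<^sub>1 t = shadow Y f h l c\<^sub>2 t"
proof -
  define k where "k = nat \<lfloor>t / l\<rfloor>"
  have "real k \<le> t / l"
    using assms by (simp add: k_def)
  then have "real k * l \<le> t"
    using assms by (simp add: field_simps)
  moreover have "real (k - 1) * h \<le> real k * h" "real k * h \<le> real k * l"
    using assms by (auto intro: mult_right_mono mult_left_mono)
  ultimately have "real k * h \<le> \<tau>" "real (k - 1) * h \<le> \<tau>"
    using assms(4) unfolding atLeastAtMost_iff by linarith+
  then have "real k * h \<in> {0..\<tau>}" "real (k - 1) * h \<in> {0..\<tau>}"
    using assms(1) unfolding atLeastAtMost_iff by (intro conjI mult_nonneg_nonneg; simp)+
  with assms(3) show ?thesis
    using assms(4) by (simp add: shadow_def Let_def flip: k_def)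
qed

text \<open>
  The slack \<open>2\<delta>\<close> in \<open>l\<close>, one \<open>\<delta>\<close> more than the distortion costs, keeps \<open>l\<close> strictly above the
  distance of the points to be joined, as curves in a length space require.
\<close>

locale coarse_map =
  fixes X :: "'a metric" and Y :: "'b metric" and f :: "'a \<Rightarrow> 'b" and \<delta> h l :: real
  assumes length_space: "length_space Y"
    and maps: "x \<in> mspace X \<Longrightarrow> f x \<in> mspace Y"
    and coarse: "x \<in> mspace X \<Longrightarrow> x' \<in> mspace X \<Longrightarrow> mdist Y (f x) (f x') \<le> mdist X x x' + \<delta>"
    and \<delta>: "0 < \<delta>" and h: "0 < h" and l: "l = h + 2 * \<delta>"
begin

abbreviation "sh \<equiv> shadow Y f h l"

context
  fixes c assumes c: "c \<in> Lip1 X"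
begin

text \<open>The points that the shadow visits at the times \<open>k * l\<close>: the image of sample \<open>0\<close> occurs twice.\<close>

abbreviation (input) "z k \<equiv> f (c (real (k - 1) * h))"

lemma c_in: "c (real k * h) \<in> mspace X"
  using h by (intro Lip1_mspace[OF c]) auto

lemma z_in: "z k \<in> mspace Y"
  by (intro maps c_in)

lemma z_step: "mdist Y (z k) (z (Suc k)) < l"
proof -
  have "mdist Y (z k) (z (Suc k)) \<le> mdist X (c (real (k - 1) * h)) (c (real k * h)) + \<delta>"
    using coarse[OF c_in c_in] by simp
  also have "mdist X (c (real (k - 1) * h)) (c (real k * h)) \<le> \<bar>real (k - 1) * h - real k * h\<bar>"
    using h by (intro Lip1_mdist[OF c]) auto
  also have "\<dots> \<le> h"
    using h by (cases k) (auto simp: algebra_simps)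
  finally show ?thesis using l \<delta> by simp
qed

text \<open>
  The right end point is included: there the joining curve has just arrived where the next one departs.
  Consecutive segments can thus be glued.
\<close>

lemma shadow_segment:
  assumes "real k * l \<le> t" "t \<le> real (Suc k) * l"
  shows "sh c t = connect Y (z k) (z (Suc k)) l (t - real k * l)"
proof -
  have l0: "l > 0" using l h \<delta> by simp
  have t0: "t \<ge> 0" using l0 by (intro order_trans[OF _ assms(1)]) simp
  show ?thesis
  proof (cases "t = real (Suc k) * l")
    case True
    then have "nat \<lfloor>t / l\<rfloor> = Suc k" using l0 by (simp add: nat_eq_iff)
    then have "sh c t = connect Y (z (Suc k)) (z (Suc (Suc k))) l 0"
      using t0 True by (simp add: shadow_def)
    also have "\<dots> = z (Suc k)"
      by (intro connect(2) length_space z_in z_step)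
    also have "\<dots> = connect Y (z k) (z (Suc k)) l l"
      by (intro connect(3)[symmetric] length_space z_in z_step)
    finally show ?thesis using True by (simp add: algebra_simps)
  next
    case False
    then have "\<lfloor>t / l\<rfloor> = int k"
      using assms l0 by (intro floor_unique) (auto simp: field_simps)
    then have "nat \<lfloor>t / l\<rfloor> = k" by simp
    then show ?thesis using t0 by (simp add: shadow_def)
  qed
qed

lemma segment_exists:
  assumes "0 \<le> t"
  obtains k where "real k * l \<le> t" "t \<le> real (Suc k) * l"
proof
  have l0: "l > 0" using l h \<delta> by simp
  have nat: "real (nat \<lfloor>t / l\<rfloor>) = of_int \<lfloor>t / l\<rfloor>"
    using assms l0 by simp
  have *: "real (nat \<lfloor>t / l\<rfloor>) \<le> t / l" "t / l \<le> real (Suc (nat \<lfloor>t / l\<rfloor>))"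
    using nat floor_correct[of "t / l"] by linarith+
  show "real (nat \<lfloor>t / l\<rfloor>) * l \<le> t" using *(1) l0 by (simp only: le_divide_eq if_True)
  show "t \<le> real (Suc (nat \<lfloor>t / l\<rfloor>)) * l" using *(2) l0 by (simp only: divide_le_eq if_True)
qed

lemma shadow_in_mspace:
  assumes "0 \<le> t"
  shows "sh c t \<in> mspace Y"
proof -
  obtain k where k: "real k * l \<le> t" "t \<le> real (Suc k) * l"
    using segment_exists[OF assms] by blast
  show ?thesis
    unfolding shadow_segment[OF k]
    using k(1) by (intro Lip1_mspace[OF connect(1)[OF length_space z_in z_in z_step]]) simp
qed

lemma shadow_in_Lip1: "sh c \<in> Lip1 Y"
proof -
  have l0: "l > 0" using l h \<delta> by simp
  have upto: "mdist Y (sh c s) (sh c t) \<le> t - s" if "0 \<le> s" "s \<le> t" "t \<le> real n * l" for n s t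
    using that
  proof (induction n arbitrary: s t)
    case 0
    then have "s = 0" "t = 0" by auto
    then show ?case using shadow_in_mspace[of 0] by simp
  next
    case (Suc n)
    show ?case
    proof (rule Lipschitz_glue[where c = "sh c" and b = "real n * l" and e = "real (Suc n) * l"])
      show "mdist Y (sh c s) (sh c t) \<le> t - s"
        if "real n * l \<le> s" "s \<le> t" "t \<le> real (Suc n) * l" for s t
        using that shadow_segment[of n s] shadow_segment[of n t]
          Lip1_mdist[OF connect(1)[OF length_space z_in z_in z_step[of n]],
            of "s - real n * l" "t - real n * l"]
        by simp
    qed (use Suc l0 shadow_in_mspace in auto)
  qed
  have "restrict (sh c) {0..} \<in> Lip1 Y"
  proof (rule restrict_in_Lip1)
    fix s t :: real assume st: "0 \<le> s" "s \<le> t"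
    then obtain k where "t \<le> real (Suc k) * l"
      using segment_exists[of t] by auto
    then show "mdist Y (sh c s) (sh c t) \<le> t - s"
      using upto st by blast
  qed (rule shadow_in_mspace)
  then show ?thesis by (simp add: shadow_def)
qed

lemma shadow_0: "sh c 0 = f (c 0)"
  using shadow_segment[of 0 0] connect(2)[OF length_space z_in z_in z_step[of 0]] l h \<delta> by simp

text \<open>
  Let \<open>t\<close> lie in the \<open>k\<close>-th segment. The shadow reaches the image of sample \<open>k\<close> within time \<open>l\<close>, so
  that image is at distance at most \<open>l\<close>. The sample itself was taken at \<open>k h\<close>, which precedes \<open>t\<close> by
  at most \<open>l\<close> for the delay plus \<open>k (l - h) = 2\<delta>k\<close> for the slower clock, and \<open>k \<le> T / h\<close>.
\<close>

lemma shadow_close: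
  assumes t: "0 \<le> t" "t \<le> T" and \<eta>: "\<eta> = h + 2 * \<delta> + 2 * \<delta> * T / h"
  obtains s where "0 \<le> s" "\<bar>t - s\<bar> \<le> \<eta>" "mdist Y (sh c t) (f (c s)) \<le> \<eta>"
proof -
  have l0: "l > 0" using l h \<delta> by simp
  obtain k where k: "real k * l \<le> t" "t \<le> real (Suc k) * l"
    using segment_exists[OF t(1)] by blast
  have "real k * h \<le> real k * l"
    using l \<delta> by (intro mult_left_mono) auto
  moreover have "real k * (2 * \<delta>) \<le> 2 * \<delta> * T / h"
  proof -
    have "real k * h \<le> T" using k(1) t(2) \<open>real k * h \<le> real k * l\<close> by simp
    then have "2 * \<delta> * (real k * h) \<le> 2 * \<delta> * T" using \<delta> by (intro mult_left_mono) auto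
    then show ?thesis using h by (simp add: field_simps)
  qed
  ultimately have lag: "\<bar>t - real k * h\<bar> \<le> \<eta>"
    using k unfolding \<eta> l by (simp add: algebra_simps abs_le_iff)
  have "mdist Y (sh c t) (z (Suc k)) \<le> \<bar>(t - real k * l) - l\<bar>"
    using Lip1_mdist[OF connect(1)[OF length_space z_in z_in z_step[of k]], of "t - real k * l" l]
      connect(3)[OF length_space z_in z_in z_step[of k]] shadow_segment[OF k] k(1) l0 by simp
  also have "\<dots> \<le> l" using k l0 by (auto simp: algebra_simps abs_le_iff)
  also have "\<dots> \<le> \<eta>" using t \<delta> h unfolding \<eta> l by simp
  finally show ?thesis
    using lag h by (intro that[of "real k * h"]) auto
qed

end

end


section \<open>Transfer of strategies along a correspondence\<close>

definition correspondence :: "'a metric \<Rightarrow> 'b metric \<Rightarrow> real \<Rightarrow> ('a \<times> 'b) set \<Rightarrow> bool" where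
  "correspondence X Y \<delta> R \<longleftrightarrow> R \<subseteq> mspace X \<times> mspace Y \<and>
     (\<forall>x\<in>mspace X. \<exists>y. (x, y) \<in> R) \<and> (\<forall>y\<in>mspace Y. \<exists>x. (x, y) \<in> R) \<and>
     (\<forall>(x, y)\<in>R. \<forall>(x', y')\<in>R. \<bar>mdist X x x' - mdist Y y y'\<bar> \<le> \<delta>)"

lemma correspondence_converse:
  "correspondence X Y \<delta> R \<Longrightarrow> correspondence Y X \<delta> (R\<inverse>)"
  unfolding correspondence_def by (auto simp: abs_minus_commute)

lemma INF_mdist_le_iff:
  fixes T :: real
  assumes "T > 0"
  shows "(INF t\<in>{0..T}. mdist X (a t) (b t)) \<le> \<alpha> \<longleftrightarrow>
    (\<forall>\<epsilon>>0. \<exists>t\<in>{0..T}. mdist X (a t) (b t) < \<alpha> + \<epsilon>)" (is "?I \<le> \<alpha> \<longleftrightarrow> _")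
proof -
  have bdd: "bdd_below ((\<lambda>t. mdist X (a t) (b t)) ` {0..T})" by (intro bdd_belowI[of _ 0]) auto
  have "?I < \<beta> \<longleftrightarrow> (\<exists>t\<in>{0..T}. mdist X (a t) (b t) < \<beta>)" for \<beta>
    using assms bdd by (intro cINF_less_iff) auto
  moreover have "?I \<le> \<alpha> \<longleftrightarrow> (\<forall>\<epsilon>>0. ?I < \<alpha> + \<epsilon>)"
    by (meson add_strict_increasing2 field_le_epsilon le_add_same_cancel1 less_add_same_cancel1
        less_imp_le order_le_less_trans)
  ultimately show ?thesis by simp
qed

text \<open>
  Both choice functions \<open>\<psi>\<close> (for Man's curve) and \<open>\<phi>\<close> (for Lion's answer) are taken from the same
  correspondence, so that the distance between \<open>y\<close> and \<open>\<phi> x\<close> differs from the one between \<open>\<psi> y\<close> and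
  \<open>x\<close> by at most \<open>\<delta>\<close>. Comparing the capture on \<open>X\<close> with the positions on \<open>Y\<close> costs \<open>2\<eta>\<close> for each
  player: once for the distance of the shadow from the image of a sample, and once for the motion of
  the original since that sample.
\<close>

lemma winning_strategies_transfer:
  fixes X :: "'a metric" and Y :: "'b metric"
  assumes len: "length_space X" "length_space Y"
    and R: "correspondence X Y \<delta> R"
    and pos: "0 < \<delta>" "0 < h" "0 < T"
    and win: "winning_strategies X \<alpha> T"
    and \<beta>: "\<alpha> + 4 * (h + 2 * \<delta> + 2 * \<delta> * T / h) + \<delta> \<le> \<beta>"
  shows "winning_strategies Y \<beta> T"
  unfolding winning_strategies_def
proof
  fix y\<^sub>0 assume y0: "y\<^sub>0 \<in> mspace Y"
  have RXY: "x \<in> mspace X" "y \<in> mspace Y" if "(x, y) \<in> R" for x y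
    using R that by (auto simp: correspondence_def)
  have dis: "\<bar>mdist X x x' - mdist Y y y'\<bar> \<le> \<delta>" if "(x, y) \<in> R" "(x', y') \<in> R" for x y x' y'
    using R that unfolding correspondence_def by blast
  obtain \<psi> where \<psi>: "\<And>y. y \<in> mspace Y \<Longrightarrow> (\<psi> y, y) \<in> R"
    using R unfolding correspondence_def by metis
  \<comment> \<open>Choosing the partner \<open>y\<^sub>0\<close> for \<open>\<psi> y\<^sub>0\<close> makes the translated answer start exactly at \<open>y\<^sub>0\<close>.\<close>
  have "\<exists>y. (x, y) \<in> R \<and> (x = \<psi> y\<^sub>0 \<longrightarrow> y = y\<^sub>0)" if "x \<in> mspace X" for x
    using R \<psi>[OF y0] that unfolding correspondence_def by metis
  then obtain \<phi> where \<phi>: "\<And>x. x \<in> mspace X \<Longrightarrow> (x, \<phi> x) \<in> R"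
    and \<phi>0: "\<phi> (\<psi> y\<^sub>0) = y\<^sub>0"
    using RXY(1)[OF \<psi>[OF y0]] by metis
  define l where "l = h + 2 * \<delta>"
  define \<eta> where "\<eta> = h + 2 * \<delta> + 2 * \<delta> * T / h"
  interpret Man: coarse_map Y X \<psi> \<delta> h l
  proof
    show "mdist X (\<psi> y) (\<psi> y') \<le> mdist Y y y' + \<delta>" if "y \<in> mspace Y" "y' \<in> mspace Y" for y y'
      using dis[OF \<psi> \<psi>, OF that] by simp
    show "\<psi> y \<in> mspace X" if "y \<in> mspace Y" for y
      using RXY(1)[OF \<psi>[OF that]] .
  qed (use pos len in \<open>auto simp: l_def\<close>)
  interpret Lion: coarse_map X Y \<phi> \<delta> h l
  proof
    show "mdist Y (\<phi> x) (\<phi> x') \<le> mdist X x x' + \<delta>" if "x \<in> mspace X" "x' \<in> mspace X" for x x'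
      using dis[OF \<phi> \<phi>, OF that] by simp
    show "\<phi> x \<in> mspace Y" if "x \<in> mspace X" for x
      using RXY(2)[OF \<phi>[OF that]] .
  qed (use pos len in \<open>auto simp: l_def\<close>)
  have hl: "h \<le> l" using pos by (simp add: l_def)
  obtain \<sigma> where \<sigma>: "nonanticipative_strategy X (\<psi> y\<^sub>0) \<sigma>"
    and catch: "\<And>M. M \<in> Lip1 X \<Longrightarrow> (INF t\<in>{0..T}. mdist X (M t) (\<sigma> M t)) \<le> \<alpha>"
    using win RXY(1)[OF \<psi>[OF y0]] unfolding winning_strategies_def by blast
  have \<sigma>_Lip1: "\<sigma> M \<in> Lip1 X" if "M \<in> Lip1 X" for M
    using \<sigma> that by (auto simp: nonanticipative_strategy_def)
  define \<sigma>' where "\<sigma>' M = Lion.sh (\<sigma> (Man.sh M))" for M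
  have strat: "nonanticipative_strategy Y y\<^sub>0 \<sigma>'"
    unfolding nonanticipative_strategy_def
  proof (intro conjI ballI allI impI)
    show "\<sigma>' \<in> Lip1 Y \<rightarrow> Lip1 Y"
      unfolding \<sigma>'_def by (auto intro: Lion.shadow_in_Lip1 \<sigma>_Lip1 Man.shadow_in_Lip1)
    show "\<sigma>' M 0 = y\<^sub>0" if "M \<in> Lip1 Y" for M
    proof -
      have "\<sigma>' M 0 = \<phi> (\<sigma> (Man.sh M) 0)"
        unfolding \<sigma>'_def using that by (intro Lion.shadow_0 \<sigma>_Lip1 Man.shadow_in_Lip1)
      then show ?thesis
        using \<sigma> \<phi>0 Man.shadow_in_Lip1[OF that] by (simp add: nonanticipative_strategy_def)
    qed
    fix M\<^sub>1 M\<^sub>2 \<tau> t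
    assume M: "M\<^sub>1 \<in> Lip1 Y" "M\<^sub>2 \<in> Lip1 Y" and \<tau>: "(0::real) \<le> \<tau>"
      and eq: "\<forall>t\<in>{0..\<tau>}. M\<^sub>1 t = M\<^sub>2 t" and t: "t \<in> {0..\<tau>}"
    have "Man.sh M\<^sub>1 t = Man.sh M\<^sub>2 t" if "t \<in> {0..\<tau>}" for t
      using eq that by (intro shadow_cong[OF pos(2) hl]) auto
    then have "\<sigma> (Man.sh M\<^sub>1) t = \<sigma> (Man.sh M\<^sub>2) t" if "t \<in> {0..\<tau>}" for t
      using \<sigma> Man.shadow_in_Lip1 M \<tau> that unfolding nonanticipative_strategy_def by blast
    then show "\<sigma>' M\<^sub>1 t = \<sigma>' M\<^sub>2 t"
      unfolding \<sigma>'_def using t by (intro shadow_cong[OF pos(2) hl]) auto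
  qed
  have "(INF t\<in>{0..T}. mdist Y (M t) (\<sigma>' M t)) \<le> \<beta>" if M: "M \<in> Lip1 Y" for M
    unfolding INF_mdist_le_iff[OF pos(3)]
  proof (intro allI impI)
    fix \<epsilon> :: real assume "\<epsilon> > 0"
    define M' where "M' = Man.sh M"
    define L' where "L' = \<sigma> M'"
    have M': "M' \<in> Lip1 X" and L': "L' \<in> Lip1 X"
      using M by (auto simp: M'_def L'_def intro: \<sigma>_Lip1 Man.shadow_in_Lip1)
    obtain t where t: "0 \<le> t" "t \<le> T" and near: "mdist X (M' t) (L' t) < \<alpha> + \<epsilon>"
      using catch[OF M'] \<open>\<epsilon> > 0\<close> unfolding INF_mdist_le_iff[OF pos(3)] L'_def
      by (meson atLeastAtMost_iff)
    obtain s where s: "0 \<le> s" "\<bar>t - s\<bar> \<le> \<eta>" and Ms: "mdist X (M' t) (\<psi> (M s)) \<le> \<eta>"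
      using Man.shadow_close[OF M t \<eta>_def] unfolding M'_def by blast
    obtain s' where s': "0 \<le> s'" "\<bar>t - s'\<bar> \<le> \<eta>" and Ls: "mdist Y (\<sigma>' M t) (\<phi> (L' s')) \<le> \<eta>"
      using Lion.shadow_close[OF L' t \<eta>_def] unfolding \<sigma>'_def L'_def M'_def by blast
    have in_X: "\<psi> (M s) \<in> mspace X" "M' t \<in> mspace X" "L' t \<in> mspace X" "L' s' \<in> mspace X"
      using RXY(1)[OF \<psi>[OF Lip1_mspace[OF M s(1)]]] Lip1_mspace[OF M' t(1)]
        Lip1_mspace[OF L' t(1)] Lip1_mspace[OF L' s'(1)] by auto
    have in_Y: "M t \<in> mspace Y" "M s \<in> mspace Y" "\<phi> (L' s') \<in> mspace Y" "\<sigma>' M t \<in> mspace Y"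
      using Lip1_mspace[OF M t(1)] Lip1_mspace[OF M s(1)] RXY(2)[OF \<phi>[OF in_X(4)]]
        Lip1_mspace[OF Lion.shadow_in_Lip1[OF L'] t(1)]
      by (auto simp: \<sigma>'_def L'_def M'_def)
    have "mdist X (\<psi> (M s)) (L' s') < \<eta> + (\<alpha> + \<epsilon>) + \<eta>"
      using mdist_triangle[of "\<psi> (M s)" X "M' t" "L' s'"] mdist_triangle[of "M' t" X "L' t" "L' s'"]
        in_X Ms near Lip1_mdist[OF L' t(1) s'(1)] s'(2) mdist_commute[of X "M' t" "\<psi> (M s)"] by linarith
    moreover have "mdist Y (M s) (\<phi> (L' s')) \<le> mdist X (\<psi> (M s)) (L' s') + \<delta>"
      using dis[OF \<psi>[OF in_Y(2)] \<phi>[OF in_X(4)]] by linarith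
    moreover have "mdist Y (M t) (\<sigma>' M t) \<le> \<eta> + mdist Y (M s) (\<phi> (L' s')) + \<eta>"
      using mdist_triangle[of "M t" Y "M s" "\<sigma>' M t"] mdist_triangle[of "M s" Y "\<phi> (L' s')" "\<sigma>' M t"]
        in_Y Ls Lip1_mdist[OF M t(1) s(1)] s(2) mdist_commute[of Y "\<sigma>' M t" "\<phi> (L' s')"] by linarith
    ultimately have "mdist Y (M t) (\<sigma>' M t) < \<beta> + \<epsilon>"
      using \<beta> unfolding \<eta>_def[symmetric] by linarith
    then show "\<exists>t\<in>{0..T}. mdist Y (M t) (\<sigma>' M t) < \<beta> + \<epsilon>"
      using t by auto
  qed
  with strat show "\<exists>\<sigma>. nonanticipative_strategy Y y\<^sub>0 \<sigma> \<and>
      (\<forall>M\<in>Lip1 Y. (INF t\<in>{0..T}. mdist Y (M t) (\<sigma> M t)) \<le> \<beta>)"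
    by blast
qed

lemma winning_strategies_mono:
  assumes "winning_strategies X \<alpha> T" "\<alpha> \<le> \<beta>"
  shows "winning_strategies X \<beta> T"
  using assms unfolding winning_strategies_def by (meson order_trans)

text \<open>If the radius is at least the diameter, Lion wins without moving.\<close>

lemma winning_strategies_bounded:
  assumes bounded: "\<And>x y. x \<in> mspace X \<Longrightarrow> y \<in> mspace X \<Longrightarrow> mdist X x y \<le> B" and "T > 0"
  shows "winning_strategies X B T"
  unfolding winning_strategies_def
proof
  fix x assume x: "x \<in> mspace X"
  define \<sigma> where "\<sigma> = (\<lambda>M::real \<Rightarrow> 'a. \<lambda>t\<in>{0::real..}. x)"
  have "nonanticipative_strategy X x \<sigma>"
    using const_in_Lip1[OF x] by (auto simp: nonanticipative_strategy_def \<sigma>_def)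
  moreover have "(INF t\<in>{0..T}. mdist X (M t) (\<sigma> M t)) \<le> B" if "M \<in> Lip1 X" for M
    unfolding INF_mdist_le_iff[OF \<open>T > 0\<close>]
  proof (intro allI impI bexI)
    fix \<epsilon> :: real assume "\<epsilon> > 0"
    then show "mdist X (M 0) (\<sigma> M 0) < B + \<epsilon>"
      using bounded[OF Lip1_mspace[OF that, of 0] x] by (simp add: \<sigma>_def)
  qed (use \<open>T > 0\<close> in auto)
  ultimately show "\<exists>\<sigma>. nonanticipative_strategy X x \<sigma> \<and>
      (\<forall>M\<in>Lip1 X. (INF t\<in>{0..T}. mdist X (M t) (\<sigma> M t)) \<le> B)"
    by blast
qed

text \<open>
  Pairs of points whose copies in the common space are less than \<open>r\<close> apart form a correspondence;
  replacing one pair by another changes distances by at most \<open>2r\<close>.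
\<close>

lemma gh_dist_less_imp_correspondence:
  assumes "gh_dist X Y < ennreal r"
  shows "\<exists>R. correspondence X Y (2 * r) R"
proof -
  obtain r' and Z :: "('a + 'b) metric" and X' Y' where r': "ennreal r' < ennreal r" "r' > 0"
    and sub: "X' \<subseteq> mspace Z" "Y' \<subseteq> mspace Z"
    and iso: "isometric X (submetric Z X')" "isometric Y (submetric Z Y')"
    and hd: "hausdorff_dist Z X' Y' < ennreal r'"
    using assms unfolding gh_dist_def Inf_less_iff by blast
  have "r' < r" using r' by (simp add: ennreal_less_iff)
  obtain f where f: "bij_betw f (mspace X) X'"
      "\<And>x x'. x \<in> mspace X \<Longrightarrow> x' \<in> mspace X \<Longrightarrow> mdist Z (f x) (f x') = mdist X x x'"
    using sub(1) iso(1) by (auto simp: isometric_def Int_absorb2)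
  obtain g where g: "bij_betw g (mspace Y) Y'"
      "\<And>y y'. y \<in> mspace Y \<Longrightarrow> y' \<in> mspace Y \<Longrightarrow> mdist Z (g y) (g y') = mdist Y y y'"
    using sub(2) iso(2) by (auto simp: isometric_def Int_absorb2)
  have fX: "f x \<in> X'" if "x \<in> mspace X" for x using f(1) that by (auto simp: bij_betw_def)
  have gY: "g y \<in> Y'" if "y \<in> mspace Y" for y using g(1) that by (auto simp: bij_betw_def)
  define R where "R = {(x, y). x \<in> mspace X \<and> y \<in> mspace Y \<and> mdist Z (f x) (g y) < r'}"
  have "\<exists>y. (x, y) \<in> R" if x: "x \<in> mspace X" for x
  proof -
    have "(INF b\<in>Y'. ennreal (mdist Z (f x) b)) \<le> (SUP a\<in>X'. INF b\<in>Y'. ennreal (mdist Z a b))"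
      by (rule SUP_upper[OF fX[OF x]])
    also have "\<dots> < ennreal r'"
      using hd unfolding hausdorff_dist_def by simp
    finally obtain b where b: "b \<in> Y'" "mdist Z (f x) b < r'"
      by (auto simp: INF_less_iff ennreal_less_iff)
    then obtain y where "y \<in> mspace Y" "b = g y" using g(1) by (auto simp: bij_betw_def)
    with b x show ?thesis by (auto simp: R_def)
  qed
  moreover have "\<exists>x. (x, y) \<in> R" if y: "y \<in> mspace Y" for y
  proof -
    have "(INF a\<in>X'. ennreal (mdist Z a (g y))) \<le> (SUP b\<in>Y'. INF a\<in>X'. ennreal (mdist Z a b))"
      by (rule SUP_upper[OF gY[OF y]])
    also have "\<dots> < ennreal r'"
      using hd unfolding hausdorff_dist_def by simp
    finally obtain a where a: "a \<in> X'" "mdist Z a (g y) < r'"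
      by (auto simp: INF_less_iff ennreal_less_iff)
    then obtain x where "x \<in> mspace X" "a = f x" using f(1) by (auto simp: bij_betw_def)
    with a y show ?thesis by (auto simp: R_def)
  qed
  moreover have "\<bar>mdist X x x' - mdist Y y y'\<bar> \<le> 2 * r" if R: "(x, y) \<in> R" "(x', y') \<in> R" for x y x' y'
  proof -
    have xy: "x \<in> mspace X" "x' \<in> mspace X" "y \<in> mspace Y" "y' \<in> mspace Y"
      and d: "mdist Z (f x) (g y) < r'" "mdist Z (f x') (g y') < r'"
      using R by (auto simp: R_def)
    have Z: "f x \<in> mspace Z" "f x' \<in> mspace Z" "g y \<in> mspace Z" "g y' \<in> mspace Z"
      using xy fX gY sub by auto
    have "\<bar>mdist Z (f x) (f x') - mdist Z (g y) (g y')\<bar> \<le> 2 * r"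
      using mdist_triangle[of "f x" Z "g y" "f x'"] mdist_triangle[of "g y" Z "g y'" "f x'"]
        mdist_triangle[of "g y" Z "f x" "g y'"] mdist_triangle[of "f x" Z "f x'" "g y'"]
        mdist_commute[of Z "g y" "f x"] mdist_commute[of Z "g y'" "f x'"] Z d \<open>r' < r\<close> by linarith
    then show ?thesis using f(2) g(2) xy by simp
  qed
  ultimately have "correspondence X Y (2 * r) R"
    unfolding correspondence_def by (auto simp: R_def)
  then show ?thesis by blast
qed


section \<open>Finite metric graphs\<close>

locale metric_graph = fin_digraph \<Gamma>
  for \<Gamma> :: "('v, 'e) pre_digraph" +
  fixes len :: "'e \<Rightarrow> real" and f :: "('v, 'e) graph_point \<Rightarrow> 'b" and G :: "'b metric"
  assumes connected: "Digraph_Component.connected \<Gamma>"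
    and len_pos: "e \<in> arcs \<Gamma> \<Longrightarrow> len e > 0"
    and bij: "bij_betw f (graph_points \<Gamma> len) (mspace G)"
    and mdist_eq: "p \<in> graph_points \<Gamma> len \<Longrightarrow> q \<in> graph_points \<Gamma> len \<Longrightarrow>
           mdist G (f p) (f q) = graph_dist \<Gamma> len p q"
begin

abbreviation "points \<equiv> graph_points \<Gamma> len"
abbreviation "gpath \<equiv> graph_path \<Gamma> len"
abbreviation "edge \<equiv> edge_point \<Gamma> len"

lemma edge_in_points: "e \<in> arcs \<Gamma> \<Longrightarrow> t \<in> {0..len e} \<Longrightarrow> edge e t \<in> points"
  by (auto simp: edge_point_def graph_points_def)

lemma path_endpoints: "gpath p q L \<Longrightarrow> p \<in> points \<and> q \<in> points"
  by (induction rule: graph_path.induct) (auto intro: edge_in_points)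

lemma path_nonneg: "gpath p q L \<Longrightarrow> 0 \<le> L"
  by (induction rule: graph_path.induct) auto

lemma path_trans: "gpath p q L \<Longrightarrow> gpath q r L' \<Longrightarrow> gpath p r (L + L')"
  by (induction rule: graph_path.induct) (auto simp: add.assoc intro: graph_path.piece)

lemma path_edge:
  assumes "e \<in> arcs \<Gamma>" "s \<in> {0..len e}" "t \<in> {0..len e}"
  shows "gpath (edge e s) (edge e t) \<bar>s - t\<bar>"
  using graph_path.piece[OF assms graph_path.trivial[OF edge_in_points[OF assms(1,3)]]] by simp

lemma point_on_edge:
  assumes "p \<in> points"
  obtains v where "p = Vertex v" "v \<in> verts \<Gamma>"
  | e t where "p = edge e t" "e \<in> arcs \<Gamma>" "t \<in> {0..len e}"
proof -
  consider v where "p = Vertex v" "v \<in> verts \<Gamma>"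
    | e t where "p = Interior e t" "e \<in> arcs \<Gamma>" "0 < t" "t < len e"
    using assms by (auto simp: graph_points_def)
  then show thesis
  proof cases
    case (2 e t)
    then show thesis by (intro that(2)[of e t]) (auto simp: edge_point_def)
  qed (rule that(1))
qed

text \<open>
  Every point can be joined to an end of its edge. Both directions are provided so that paths between
  arbitrary points reduce to paths between vertices; the uniform bound serves for the diameter.
\<close>

lemma path_near_vertex:
  assumes "p \<in> points"
  obtains v L L' where "v \<in> verts \<Gamma>" "gpath p (Vertex v) L" "gpath (Vertex v) p L'"
    "L \<le> sum len (arcs \<Gamma>)" "L' \<le> sum len (arcs \<Gamma>)"
  using assms
proof (cases rule: point_on_edge)
  case (1 v)
  have "0 \<le> sum len (arcs \<Gamma>)"
    using len_pos by (intro sum_nonneg) (auto intro: less_imp_le)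
  then show ?thesis
    using 1 assms by (intro that[of v 0 0]) (auto intro: graph_path.trivial)
next
  case (2 e t)
  have "len e \<le> sum len (arcs \<Gamma>)"
    using 2 len_pos finite_arcs by (intro member_le_sum) (auto intro: less_imp_le)
  moreover have "edge e 0 = Vertex (tail \<Gamma> e)" by (simp add: edge_point_def)
  ultimately show ?thesis
    using 2 path_edge[of e t 0] path_edge[of e 0 t] len_pos[of e]
    by (intro that[of "tail \<Gamma> e" t t]) auto
qed

lemma path_vertices:
  assumes "u \<in> verts \<Gamma>" "v \<in> verts \<Gamma>"
  shows "\<exists>L. gpath (Vertex u) (Vertex v) L"
proof -
  have "u \<rightarrow>\<^sup>*\<^bsub>mk_symmetric \<Gamma>\<^esub> v"
    using connected assms by (auto simp: connected_def strongly_connected_def)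
  then have "(u, v) \<in> (parcs (mk_symmetric \<Gamma>))\<^sup>*"
    using reachable_rtranclI by fastforce
  then show ?thesis
  proof (induction rule: rtrancl_induct)
    case base
    have "gpath (Vertex u) (Vertex u) 0"
      using assms by (intro graph_path.trivial) (simp add: graph_points_def)
    then show ?case ..
  next
    case (step v w)
    then obtain e where e: "e \<in> arcs \<Gamma>"
      "v = tail \<Gamma> e \<and> w = head \<Gamma> e \<or> v = head \<Gamma> e \<and> w = tail \<Gamma> e"
      by (auto simp: parcs_mk_symmetric)
    have "edge e 0 = Vertex (tail \<Gamma> e)" "edge e (len e) = Vertex (head \<Gamma> e)"
      using len_pos[OF e(1)] by (auto simp: edge_point_def)
    then have "\<exists>L. gpath (Vertex v) (Vertex w) L"
      using e path_edge[OF e(1), of 0 "len e"] path_edge[OF e(1), of "len e" 0] len_pos[OF e(1)]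
      by auto
    with step.IH show ?case using path_trans by blast
  qed
qed

text \<open>
  Without this lemma the infimum in \<open>graph_dist\<close> could range over the empty set, where its value
  says nothing.
\<close>

lemma path_exists:
  assumes "p \<in> points" "q \<in> points"
  shows "\<exists>L. gpath p q L"
proof -
  obtain u L1 where "u \<in> verts \<Gamma>" "gpath p (Vertex u) L1"
    using path_near_vertex[OF assms(1)] by blast
  moreover obtain v L2 where "v \<in> verts \<Gamma>" "gpath (Vertex v) q L2"
    using path_near_vertex[OF assms(2)] by blast
  ultimately show ?thesis
    using path_vertices path_trans by metis
qed

lemma mdist_le_path:
  assumes "gpath p q L"
  shows "mdist G (f p) (f q) \<le> L"
proof -
  have "graph_dist \<Gamma> len p q \<le> L"
    unfolding graph_dist_def using assms path_nonneg
    by (intro cInf_lower bdd_belowI[of _ 0]) auto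
  then show ?thesis
    using path_endpoints[OF assms] by (simp add: mdist_eq)
qed

lemma f_in_mspace: "p \<in> points \<Longrightarrow> f p \<in> mspace G"
  using bij by (auto simp: bij_betw_def)

lemma curve_along_edge:
  assumes e: "e \<in> arcs \<Gamma>" and s: "s \<in> {0..len e}" and t: "t \<in> {0..len e}"
  obtains c where "c \<in> Lip1 G" "c 0 = f (edge e s)" "c \<bar>s - t\<bar> = f (edge e t)"
proof -
  define u where "u \<tau> = (if s \<le> t then min t (s + \<tau>) else max t (s - \<tau>))" for \<tau>
  have u: "u \<tau> \<in> {0..len e}" if "0 \<le> \<tau>" for \<tau>
    using that s t by (auto simp: u_def)
  have "(\<lambda>\<tau>\<in>{0..}. f (edge e (u \<tau>))) \<in> Lip1 G"
  proof (rule restrict_in_Lip1)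
    show "f (edge e (u \<tau>)) \<in> mspace G" if "0 \<le> \<tau>" for \<tau>
      using u[OF that] e by (intro f_in_mspace edge_in_points)
    show "mdist G (f (edge e (u a))) (f (edge e (u b))) \<le> b - a" if "0 \<le> a" "a \<le> b" for a b
    proof -
      have "mdist G (f (edge e (u a))) (f (edge e (u b))) \<le> \<bar>u a - u b\<bar>"
        using that u e by (intro mdist_le_path path_edge) auto
      also have "\<dots> \<le> b - a" using that by (auto simp: u_def)
      finally show ?thesis .
    qed
  qed
  moreover have "u 0 = s" "u \<bar>s - t\<bar> = t" by (auto simp: u_def)
  ultimately show ?thesis
    by (intro that[of "\<lambda>\<tau>\<in>{0..}. f (edge e (u \<tau>))"]) (simp_all only: restrict_apply, simp_all)
qed

lemma curve_along_path:
  assumes "gpath p q L"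
  shows "\<exists>c\<in>Lip1 G. c 0 = f p \<and> c L = f q"
  using assms
proof (induction rule: graph_path.induct)
  case (trivial p)
  then show ?case
    using const_in_Lip1[OF f_in_mspace] by (intro bexI[of _ "\<lambda>t\<in>{0..}. f p"]) auto
next
  case (piece e s t q L)
  obtain c1 where c1: "c1 \<in> Lip1 G" "c1 0 = f (edge e s)" "c1 \<bar>s - t\<bar> = f (edge e t)"
    using curve_along_edge piece.hyps by blast
  obtain c2 where c2: "c2 \<in> Lip1 G" "c2 0 = f (edge e t)" "c2 L = f q"
    using piece.IH by blast
  obtain c where "c \<in> Lip1 G" "c 0 = c1 0" "\<And>b. 0 \<le> b \<Longrightarrow> c (\<bar>s - t\<bar> + b) = c2 b"
    using Lip1_concat[OF c1(1) c2(1), of "\<bar>s - t\<bar>"] c1(3) c2(2) by auto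
  then show ?case
    using c1 c2 path_nonneg[OF piece.hyps(4)] by (intro bexI[of _ c]) auto
qed

lemma length_space_graph: "length_space G"
  unfolding length_space_def
proof (intro ballI allI impI)
  fix x y l assume "x \<in> mspace G" "y \<in> mspace G" and l: "mdist G x y < l"
  then obtain p q where pq: "p \<in> points" "q \<in> points" "x = f p" "y = f q"
    using bij unfolding bij_betw_def by blast
  have "graph_dist \<Gamma> len p q < l"
    using l pq mdist_eq by simp
  then obtain L where L: "gpath p q L" "L < l"
    unfolding graph_dist_def using path_exists[OF pq(1,2)] by (auto dest!: cInf_lessD[rotated])
  obtain c where c: "c \<in> Lip1 G" "c 0 = x" "c L = y"
    using curve_along_path[OF L(1)] pq by blast
  obtain c' where "c' \<in> Lip1 G" "c' 0 = c 0" "\<And>t. L \<le> t \<Longrightarrow> c' t = c L"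
    using Lip1_stop[OF c(1) path_nonneg[OF L(1)]] by blast
  then show "\<exists>c\<in>Lip1 G. c 0 = x \<and> c l = y"
    using c L(2) by (intro bexI[of _ c']) auto
qed

text \<open>
  Every point is near one of the finitely many vertices. The sum over all pairs of vertices is a
  convenient bound for their mutual distances.
\<close>

lemma graph_bounded:
  obtains B where "\<And>x y. x \<in> mspace G \<Longrightarrow> y \<in> mspace G \<Longrightarrow> mdist G x y \<le> B"
proof -
  define D where "D = (\<Sum>u\<in>verts \<Gamma>. \<Sum>v\<in>verts \<Gamma>. mdist G (f (Vertex u)) (f (Vertex v)))"
  define S where "S = sum len (arcs \<Gamma>)"
  have V: "Vertex v \<in> points" if "v \<in> verts \<Gamma>" for v
    using that by (simp add: graph_points_def)
  have D: "mdist G (f (Vertex u)) (f (Vertex v)) \<le> D" if "u \<in> verts \<Gamma>" "v \<in> verts \<Gamma>" for u v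
  proof -
    have "mdist G (f (Vertex u)) (f (Vertex v)) \<le> (\<Sum>v\<in>verts \<Gamma>. mdist G (f (Vertex u)) (f (Vertex v)))"
      using that finite_verts by (intro member_le_sum) auto
    also have "\<dots> \<le> D"
      unfolding D_def using that finite_verts
      by (intro member_le_sum[where f = "\<lambda>u. \<Sum>v\<in>verts \<Gamma>. mdist G (f (Vertex u)) (f (Vertex v))"])
        (auto intro: sum_nonneg)
    finally show ?thesis .
  qed
  have "mdist G x y \<le> S + D + S" if xy: "x \<in> mspace G" "y \<in> mspace G" for x y
  proof -
    obtain p q where pq: "p \<in> points" "q \<in> points" "x = f p" "y = f q"
      using bij xy unfolding bij_betw_def by blast
    obtain u L where u: "u \<in> verts \<Gamma>" "gpath p (Vertex u) L" "L \<le> S"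
      using path_near_vertex[OF pq(1)] unfolding S_def by blast
    obtain v L' where v: "v \<in> verts \<Gamma>" "gpath (Vertex v) q L'" "L' \<le> S"
      using path_near_vertex[OF pq(2)] unfolding S_def by blast
    show ?thesis
      unfolding pq(3,4)
      using mdist_triangle[of "f p" G "f (Vertex u)" "f q"]
        mdist_triangle[of "f (Vertex u)" G "f (Vertex v)" "f q"]
        f_in_mspace[OF pq(1)] f_in_mspace[OF pq(2)] u(3) v(3) D[OF u(1) v(1)] mdist_le_path[OF u(2)] mdist_le_path[OF v(2)]
        f_in_mspace[OF V[OF u(1)]] f_in_mspace[OF V[OF v(1)]]
      by linarith
  qed
  then show ?thesis using that by blast
qed

end

lemma finite_metric_graph_properties:
  assumes "finite_metric_graph G"
  shows "length_space G" and "\<exists>B. \<forall>x\<in>mspace G. \<forall>y\<in>mspace G. mdist G x y \<le> B"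
proof -
  obtain \<Gamma> :: "(nat, nat) pre_digraph" and len f where "fin_digraph \<Gamma>" "metric_graph_axioms \<Gamma> len f G"
    using assms unfolding finite_metric_graph_def metric_graph_axioms_def by blast
  then interpret metric_graph \<Gamma> len f G
    by (simp add: metric_graph_def)
  show "length_space G" by (rule length_space_graph)
  show "\<exists>B. \<forall>x\<in>mspace G. \<forall>y\<in>mspace G. mdist G x y \<le> B" using graph_bounded by metis
qed


section \<open>Stability under Gromov-Hausdorff convergence\<close>

text \<open>
  The error \<open>4\<eta> + \<delta>\<close> equals \<open>4h + \<delta>(9 + 8T/h)\<close>. With \<open>h = \<epsilon> / 8\<close> and \<open>\<delta>\<close> chosen
  after \<open>h\<close>, each of the two summands becomes \<open>\<epsilon> / 2\<close>.
  The choice does not depend on \<open>\<alpha>\<close>, so the transfer also applies to radii that vary with \<open>n\<close>.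
\<close>

lemma eventually_winning_transfer:
  fixes X :: "'a metric" and G :: "nat \<Rightarrow> 'b metric"
  assumes len: "length_space X" "\<And>n. length_space (G n)"
    and conv: "(\<lambda>n. gh_dist X (G n)) \<longlonglongrightarrow> 0" and pos: "T > 0" "\<epsilon> > 0"
  shows "\<forall>\<^sub>F n in sequentially. \<forall>\<alpha>.
    (winning_strategies X \<alpha> T \<longrightarrow> winning_strategies (G n) (\<alpha> + \<epsilon>) T) \<and>
    (winning_strategies (G n) \<alpha> T \<longrightarrow> winning_strategies X (\<alpha> + \<epsilon>) T)"
proof -
  define h where "h = \<epsilon> / 8"
  define \<delta> where "\<delta> = \<epsilon> / (2 * (9 + 8 * T / h))"
  have h: "h > 0" using pos by (simp add: h_def)
  then have \<delta>: "\<delta> > 0" using pos by (simp add: \<delta>_def add_pos_pos)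
  have "9 + 8 * T / h > 0" using h pos by (simp add: add_pos_pos)
  then have "\<delta> * (9 + 8 * T / h) = \<epsilon> / 2"
    by (simp only: \<delta>_def) (simp only: divide_simps, simp)
  moreover have "4 * (h + 2 * \<delta> + 2 * \<delta> * T / h) + \<delta> = 4 * h + \<delta> * (9 + 8 * T / h)"
    by (simp add: algebra_simps)
  ultimately have err: "4 * (h + 2 * \<delta> + 2 * \<delta> * T / h) + \<delta> \<le> \<epsilon>"
    by (simp add: h_def)
  have "\<forall>\<^sub>F n in sequentially. gh_dist X (G n) < ennreal (\<delta> / 2)"
    using conv \<delta> by (intro order_tendstoD(2)) auto
  then show ?thesis
  proof eventually_elim
    case (elim n)
    then obtain R where R: "correspondence X (G n) \<delta> R"
      using gh_dist_less_imp_correspondence by fastforce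
    have "\<alpha> + 4 * (h + 2 * \<delta> + 2 * \<delta> * T / h) + \<delta> \<le> \<alpha> + \<epsilon>" for \<alpha>
      using err by simp
    with winning_strategies_transfer[OF len R \<delta> h pos(1)]
      winning_strategies_transfer[OF len(2,1) correspondence_converse[OF R] \<delta> h pos(1)]
    show ?case by blast
  qed
qed

theorem corollary2:
  fixes X :: "'a metric" and G :: "nat \<Rightarrow> 'b metric" and T \<alpha> :: real
  assumes "compact_space (mtopology_of X)" and "geodesic_space X"
    and "\<And>n. finite_metric_graph (G n)"
    and "T > 0" and "\<alpha> > 0"
    and "(\<lambda>n. gh_dist X (G n)) \<longlonglongrightarrow> 0"
  shows "(\<forall>\<alpha>'>\<alpha>. winning_strategies X \<alpha>' T) \<longleftrightarrow>
    (\<exists>a :: nat \<Rightarrow> real. (\<forall>n. a n > 0) \<and> a \<longlonglongrightarrow> \<alpha> \<and> (\<forall>n. winning_strategies (G n) (a n) T))"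
proof -
  note transfer = eventually_winning_transfer[OF geodesic_imp_length_space[OF assms(2)]
      finite_metric_graph_properties(1)[OF assms(3)] assms(6) assms(4)]
  show ?thesis
  proof
    assume X: "\<forall>\<alpha>'>\<alpha>. winning_strategies X \<alpha>' T"
    \<comment> \<open>Radii below \<open>\<alpha>\<close> are excluded: Lion might win on \<open>G n\<close> with some of them, but the
        sequence has to converge to \<open>\<alpha>\<close>. The summand \<open>1 / Suc n\<close> is there because the infimum itself
        need not be a winning radius.\<close>
    define A where "A n = {a. \<alpha> \<le> a \<and> winning_strategies (G n) a T}" for n
    define a where "a n = Inf (A n) + 1 / real (Suc n)" for n
    have nonempty: "A n \<noteq> {}" for n
    proof -
      obtain B where "\<forall>x\<in>mspace (G n). \<forall>y\<in>mspace (G n). mdist (G n) x y \<le> B"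
        using finite_metric_graph_properties(2)[OF assms(3)] by blast
      then have "winning_strategies (G n) B T"
        using assms(4) by (intro winning_strategies_bounded) auto
      then have "max \<alpha> B \<in> A n"
        unfolding A_def by (auto intro: winning_strategies_mono)
      then show ?thesis by blast
    qed
    have bdd: "bdd_below (A n)" for n
      by (intro bdd_belowI[of _ \<alpha>]) (simp add: A_def)
    have ge: "\<alpha> \<le> Inf (A n)" for n
      by (intro cInf_greatest nonempty) (simp add: A_def)
    have "Inf (A n) < a n" for n by (simp add: a_def)
    have win: "winning_strategies (G n) (a n) T" for n
    proof -
      obtain b where "b \<in> A n" "b < a n"
        using cInf_lessD[OF nonempty \<open>Inf (A n) < a n\<close>] by blast
      then show ?thesis
        unfolding A_def by (auto intro: winning_strategies_mono)
    qed
    have "(\<lambda>n. Inf (A n)) \<longlonglongrightarrow> \<alpha>"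
    proof (rule order_tendstoI)
      fix b assume "b < \<alpha>"
      then show "\<forall>\<^sub>F n in sequentially. b < Inf (A n)"
        using ge by (intro always_eventually allI) (rule less_le_trans)
    next
      fix b assume "\<alpha> < b"
      define \<epsilon> where "\<epsilon> = (b - \<alpha>) / 3"
      have \<epsilon>: "\<epsilon> > 0" "\<alpha> + \<epsilon> + \<epsilon> < b" using \<open>\<alpha> < b\<close> by (auto simp: \<epsilon>_def field_simps)
      show "\<forall>\<^sub>F n in sequentially. Inf (A n) < b"
        using transfer[OF \<epsilon>(1)]
      proof eventually_elim
        case (elim n)
        have "winning_strategies X (\<alpha> + \<epsilon>) T"
          using X \<epsilon>(1) by simp
        with elim have "winning_strategies (G n) (\<alpha> + \<epsilon> + \<epsilon>) T"
          by blast
        then have "\<alpha> + \<epsilon> + \<epsilon> \<in> A n" using \<epsilon>(1) by (simp add: A_def)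
        then show ?case using cInf_lower[OF _ bdd] \<epsilon>(2) by (meson le_less_trans)
      qed
    qed
    then have "a \<longlonglongrightarrow> \<alpha> + 0"
      unfolding a_def by (intro tendsto_add LIMSEQ_Suc[OF lim_1_over_n])
    moreover have "a n > 0" for n
      using ge[of n] assms(5) by (simp add: a_def add_pos_pos)
    ultimately show "\<exists>a :: nat \<Rightarrow> real. (\<forall>n. a n > 0) \<and> a \<longlonglongrightarrow> \<alpha> \<and>
        (\<forall>n. winning_strategies (G n) (a n) T)"
      using win by (intro exI[of _ a]) auto
  next
    assume "\<exists>a :: nat \<Rightarrow> real. (\<forall>n. a n > 0) \<and> a \<longlonglongrightarrow> \<alpha> \<and> (\<forall>n. winning_strategies (G n) (a n) T)"
    then obtain a where a: "a \<longlonglongrightarrow> \<alpha>" and win: "\<And>n. winning_strategies (G n) (a n) T"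
      by blast
    show "\<forall>\<alpha>'>\<alpha>. winning_strategies X \<alpha>' T"
    proof (intro allI impI)
      fix \<alpha>' assume "\<alpha> < \<alpha>'"
      define \<epsilon> where "\<epsilon> = (\<alpha>' - \<alpha>) / 2"
      have \<epsilon>: "\<epsilon> > 0" "\<alpha>' = \<alpha> + \<epsilon> + \<epsilon>" using \<open>\<alpha> < \<alpha>'\<close> by (auto simp: \<epsilon>_def field_simps)
      have "\<forall>\<^sub>F n in sequentially. a n < \<alpha> + \<epsilon>"
        using a \<epsilon>(1) by (intro order_tendstoD(2)) auto
      with transfer[OF \<epsilon>(1)] have "\<forall>\<^sub>F n in sequentially. winning_strategies X \<alpha>' T"
      proof eventually_elim
        case (elim n)
        then show ?case
          using win[of n] \<epsilon>(2) winning_strategies_mono[of X "a n + \<epsilon>" T \<alpha>'] by auto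
      qed
      then show "winning_strategies X \<alpha>' T" by simp
    qed
  qed
qed

end
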